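(* Let $PD$ be the propositional language built from propositional variables $P_0,P_1,P_2,\ldots$ (distinct) with $\neg$ and $\to$, and let $L'\subset PD$ be the propositional language built in the same way from the variables $\{P_i\mid i\geq 1\}$ (omitting $P_0$). Let $R^1$ be the set of all formulas of the following three forms with $X,Y,Z\in L'$: $X\to(Y\to X)$; $\ (X\to(Y\to Z))\to((X\to Y)\to(X\to Z))$; $\ (\neg X\to\neg Y)\to(Y\to X)$. Let $R^3(PD)=\{(X\to Y,X,Y)\mid X,Y\in PD\}$ (Modus Ponens for all of $PD$). For each integer $m\geq 1$ let $J_m=(\neg P_0\to\neg P_m)\to(P_m\to P_0)$, let $R^1_m=R^1\cup\{J_m\}$ (a unary relation on $PD$), and let $C'_m$ be the operator generated by the rules of inference $\{R^1_m,R^3(PD)\}$, i.e. $\{R^1_m,R^3(PD)\}\Rightarrow C'_m$. Then each $C'_m$ is a finite consequence operator on $\mathcal{P}(PD)$, but $\bigwedge\{C'_m\mid m\geq 1\}$ is a general consequence operator on $\mathcal{P}(PD)$ that is not a finite consequence operator.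
   Context: $\mathcal{P}(PD)$ is the power set of $PD$ and $\mathcal{F}(X)$ is the set of all finite subsets of $X$. A general consequence operator on $\mathcal{P}(PD)$ is a map $C\colon\mathcal{P}(PD)\to\mathcal{P}(PD)$ such that for all $X,Y\subset PD$: (1) $X\subset C(X)=C(C(X))$; (2) if $X\subset Y$, then $C(X)\subset C(Y)$. It is a finite consequence operator if, in addition, $C(X)=\bigcup\{C(F)\mid F\in\mathcal{F}(X)\}$ for all $X\subset PD$. For a nonempty set $\mathcal{H}$ of general consequence operators, $(\bigwedge\mathcal{H})(X)=\bigcap\{C(X)\mid C\in\mathcal{H}\}$ for $X\subset PD$; this is its infimum under the pointwise inclusion order. For a set $RI$ of relations on $PD$ (each $n$-ary for some $n\geq 1$), a deduction from $X\subset PD$ is a finite sequence $b_1,\ldots,b_m$ ($m\geq 1$) of members of $PD$ such that for each $i$ at least one of the following holds: $b_i\in X$; $b_i$ is a member of some unary relation in $RI$; there are $j\geq 1$, a $(j+1)$-ary relation $R\in RI$ and $(a_1,\ldots,a_j,a_{j+1})\in R$ with $a_1,\ldots,a_j\in\{b_1,\ldots,b_{i-1}\}$ and $b_i=a_{j+1}$. One writes $X\vdash x$ if there is such a deduction with last term $x$. The notation $RI\Rightarrow C$ means that $C(X)=\{x\in PD\mid X\vdash x\}$ for all $X\subset PD$. *)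

theory Defs
  imports Main
begin

section \<open>Consequence operators\<close>

text \<open>The underlying set of a consequence operator is the universe of the type \<open>'a\<close>.\<close>

definition general_consequence_operator :: "('a set \<Rightarrow> 'a set) \<Rightarrow> bool" where
  "general_consequence_operator C \<longleftrightarrow>
     (\<forall>X. X \<subseteq> C X \<and> C X = C (C X)) \<and> (\<forall>X Y. X \<subseteq> Y \<longrightarrow> C X \<subseteq> C Y)"

definition finite_consequence_operator :: "('a set \<Rightarrow> 'a set) \<Rightarrow> bool" where
  "finite_consequence_operator C \<longleftrightarrow>
     general_consequence_operator C \<and> (\<forall>X. C X = (\<Union>F \<in> Fpow X. C F))"

definition meet :: "('a set \<Rightarrow> 'a set) set \<Rightarrow> 'a set \<Rightarrow> 'a set" where
  "meet H X = (\<Inter>C \<in> H. C X)"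


section \<open>Rules of inference and deductions\<close>

text \<open>A tuple is encoded as the list of its entries, and a relation as a set of such lists.\<close>

definition nary :: "nat \<Rightarrow> 'a list set \<Rightarrow> bool" where
  "nary n R \<longleftrightarrow> (\<forall>t \<in> R. length t = n)"

definition deduction :: "'a list set set \<Rightarrow> 'a set \<Rightarrow> 'a list \<Rightarrow> bool" where
  "deduction RI X bs \<longleftrightarrow> bs \<noteq> [] \<and>
     (\<forall>i < length bs.
        bs ! i \<in> X \<or>
        (\<exists>R \<in> RI. nary 1 R \<and> [bs ! i] \<in> R) \<or>
        (\<exists>j \<ge> 1. \<exists>R \<in> RI. nary (j + 1) R \<and>
           (\<exists>as a. length as = j \<and> as @ [a] \<in> R \<and>
              set as \<subseteq> set (take i bs) \<and> bs ! i = a)))"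

definition deducible :: "'a list set set \<Rightarrow> 'a set \<Rightarrow> 'a \<Rightarrow> bool" where
  "deducible RI X x \<longleftrightarrow> (\<exists>bs. deduction RI X bs \<and> last bs = x)"

definition generates :: "'a list set set \<Rightarrow> ('a set \<Rightarrow> 'a set) \<Rightarrow> bool" where
  "generates RI C \<longleftrightarrow> (\<forall>X. C X = {x. deducible RI X x})"


section \<open>The propositional language\<close>

text \<open>The type \<open>form\<close> itself plays the role of \<open>PD\<close>; \<open>Var i\<close> is the variable \<open>P\<^sub>i\<close>.\<close>

datatype form =
    Var nat
  | Neg form
  | Imp form form (infixr "\<^bold>\<rightarrow>" 55)

inductive_set language :: "nat set \<Rightarrow> form set" for V :: "nat set" where
  var: "i \<in> V \<Longrightarrow> Var i \<in> language V"
| neg: "A \<in> language V \<Longrightarrow> Neg A \<in> language V"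
| imp: "A \<in> language V \<Longrightarrow> B \<in> language V \<Longrightarrow> (A \<^bold>\<rightarrow> B) \<in> language V"

definition L' :: "form set" where
  "L' = language {i. i \<ge> 1}"

definition axioms :: "form set" where
  "axioms =
     {X \<^bold>\<rightarrow> (Y \<^bold>\<rightarrow> X) | X Y. X \<in> L' \<and> Y \<in> L'} \<union>
     {(X \<^bold>\<rightarrow> (Y \<^bold>\<rightarrow> Z)) \<^bold>\<rightarrow> ((X \<^bold>\<rightarrow> Y) \<^bold>\<rightarrow> (X \<^bold>\<rightarrow> Z)) | X Y Z. X \<in> L' \<and> Y \<in> L' \<and> Z \<in> L'} \<union>
     {(Neg X \<^bold>\<rightarrow> Neg Y) \<^bold>\<rightarrow> (Y \<^bold>\<rightarrow> X) | X Y. X \<in> L' \<and> Y \<in> L'}"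

definition J :: "nat \<Rightarrow> form" where
  "J m = (Neg (Var 0) \<^bold>\<rightarrow> Neg (Var m)) \<^bold>\<rightarrow> (Var m \<^bold>\<rightarrow> Var 0)"

definition R1 :: "nat \<Rightarrow> form list set" where
  "R1 m = {[A] | A. A \<in> axioms \<union> {J m}}"

definition R3 :: "form list set" where
  "R3 = {[X \<^bold>\<rightarrow> Y, X, Y] | X Y. True}"

lemma nary_R1: "nary 1 (R1 m)"
  by (auto simp: nary_def R1_def)

lemma nary_R3: "nary 3 R3"
  by (auto simp: nary_def R3_def)

end

(* The formulas P_m and ~P_0 -> ~P_m (m >= 1) together entail P_0 under every C'_m, by J_m and two
   applications of Modus Ponens. A finite subset F of them misses some P_m, and then P_0 is not in
   C'_m(F): since the axioms only speak about L', a model may treat ~P_0 as an atom of its own.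
   Making P_0, ~P_0 and P_m false and every other variable true satisfies F and the rules
   {R^1_m, R^3(PD)}. *)

theory Submission
  imports Defs
begin

section \<open>One-step inference and its iteration in deductions\<close>

definition infers :: "'a list set set \<Rightarrow> 'a set \<Rightarrow> 'a \<Rightarrow> bool" where
  "infers RI Y a \<longleftrightarrow>
     (\<exists>R \<in> RI. nary 1 R \<and> [a] \<in> R) \<or>
     (\<exists>as R. as \<noteq> [] \<and> R \<in> RI \<and> nary (length as + 1) R \<and> as @ [a] \<in> R \<and> set as \<subseteq> Y)"

lemma infers_axiom: "R \<in> RI \<Longrightarrow> nary 1 R \<Longrightarrow> [a] \<in> R \<Longrightarrow> infers RI Y a"
  unfolding infers_def by blast

lemma infers_mono: "infers RI Y a \<Longrightarrow> Y \<subseteq> Z \<Longrightarrow> infers RI Z a"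
  unfolding infers_def by (meson order_trans)

text \<open>Tuples are finite lists, so a single rule application consults only finitely many
  members of \<open>Y\<close>, and none at all for a unary relation.\<close>

lemma infers_finite:
  assumes "infers RI Y a"
  obtains A where "finite A" "A \<subseteq> Y" "infers RI A a"
proof -
  from assms consider R where "R \<in> RI" "nary 1 R" "[a] \<in> R"
    | as R where "as \<noteq> []" "R \<in> RI" "nary (length as + 1) R" "as @ [a] \<in> R" "set as \<subseteq> Y"
    unfolding infers_def by blast
  then show thesis
  proof cases
    case 1
    then show thesis using that[of "{}"] by (simp add: infers_axiom)
  next
    case 2
    then have "infers RI (set as) a" unfolding infers_def by blast
    with 2 show thesis using that[of "set as"] by simp
  qed
qed

text \<open>Separates the premises from \<open>X\<close> from the rule applications, which are then
  monotone and finitary in the set of earlier terms. The number \<open>j\<close> is forced to be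
  \<open>length as\<close>, so it disappears and \<open>j \<ge> 1\<close> becomes
  \<open>as \<noteq> []\<close>.\<close>

lemma deduction_iff:
  "deduction RI X bs \<longleftrightarrow>
     bs \<noteq> [] \<and> (\<forall>i < length bs. bs ! i \<in> X \<or> infers RI (set (take i bs)) (bs ! i))"
proof -
  have "(\<exists>j \<ge> 1. \<exists>R \<in> RI. nary (j + 1) R \<and>
          (\<exists>as a. length as = j \<and> as @ [a] \<in> R \<and> set as \<subseteq> Y \<and> b = a)) \<longleftrightarrow>
        (\<exists>as R. as \<noteq> [] \<and> R \<in> RI \<and> nary (length as + 1) R \<and> as @ [b] \<in> R \<and> set as \<subseteq> Y)"
    for Y and b :: 'a
    by (auto simp: Suc_le_eq)
  then show ?thesis
    unfolding deduction_def infers_def by simp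
qed

text \<open>A term of \<open>cs\<close> keeps its justification because its predecessors in
  \<open>cs\<close> are still among its predecessors; the extra ones from \<open>bs\<close> do no
  harm by \<open>infers_mono\<close>.\<close>

lemma deduction_append:
  assumes "deduction RI X bs" "deduction RI X cs"
  shows "deduction RI X (bs @ cs)"
  unfolding deduction_iff
proof (intro conjI allI impI)
  show "bs @ cs \<noteq> []" using assms by (simp add: deduction_iff)
next
  fix i assume i: "i < length (bs @ cs)"
  show "(bs @ cs) ! i \<in> X \<or> infers RI (set (take i (bs @ cs))) ((bs @ cs) ! i)"
  proof (cases "i < length bs")
    case True
    then show ?thesis using assms(1) by (simp add: deduction_iff nth_append)
  next
    case False
    with i have "cs ! (i - length bs) \<in> X \<or>
        infers RI (set (take (i - length bs) cs)) (cs ! (i - length bs))"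
      using assms(2) by (simp add: deduction_iff)
    with False show ?thesis
      by (auto simp: nth_append intro: infers_mono)
  qed
qed

text \<open>Deductions are nonempty by definition, so \<open>bs = []\<close> is a separate case; it
  yields the one-term deductions.\<close>

lemma deduction_snoc:
  assumes "bs = [] \<or> deduction RI X bs" "a \<in> X \<or> infers RI (set bs) a"
  shows "deduction RI X (bs @ [a])"
  using assms by (auto simp: deduction_iff nth_append less_Suc_eq)

lemma deduction_subset_closed:
  assumes "deduction RI X bs" "X \<subseteq> S" "\<And>a. infers RI S a \<Longrightarrow> a \<in> S"
  shows "set bs \<subseteq> S"
proof -
  have "bs ! i \<in> S" if "i < length bs" for i
    using that
  proof (induction i rule: less_induct)
    case (less i)
    then have "set (take i bs) \<subseteq> S"
      by (auto simp: in_set_conv_nth)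
    moreover have "bs ! i \<in> X \<or> infers RI (set (take i bs)) (bs ! i)"
      using assms(1) less.prems by (simp add: deduction_iff)
    ultimately have "bs ! i \<in> X \<or> infers RI S (bs ! i)"
      by (metis infers_mono)
    then show ?case
      using assms(2) assms(3)[of "bs ! i"] by auto
  qed
  then show ?thesis by (auto simp: in_set_conv_nth)
qed

text \<open>Induction principle for deducibility. It serves twice: with \<open>S\<close> the set of
  deducible elements it gives cut, with \<open>S\<close> the set of true formulas it gives soundness
  of a model.\<close>

lemma deducible_closed:
  assumes "deducible RI X x" "X \<subseteq> S" "\<And>a. infers RI S a \<Longrightarrow> a \<in> S"
  shows "x \<in> S"
proof -
  obtain bs where bs: "deduction RI X bs" "last bs = x"
    using assms(1) by (auto simp: deducible_def)
  then have "x \<in> set bs" by (auto simp: deduction_iff)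
  then show ?thesis using deduction_subset_closed[OF bs(1) assms(2,3)] by blast
qed

lemma deducible_mono: "deducible RI X x \<Longrightarrow> X \<subseteq> Y \<Longrightarrow> deducible RI Y x"
  unfolding deducible_def deduction_iff by blast

lemma deducible_premise: "x \<in> X \<Longrightarrow> deducible RI X x"
  using deduction_snoc[of "[]"] by (fastforce simp: deducible_def)

lemma finite_deducible_joint_deduction:
  assumes "finite A" "\<forall>a \<in> A. deducible RI X a"
  shows "\<exists>bs. (bs = [] \<or> deduction RI X bs) \<and> A \<subseteq> set bs"
  using assms
proof (induction A rule: finite_induct)
  case empty
  then show ?case by auto
next
  case (insert a A)
  then obtain bs where bs: "bs = [] \<or> deduction RI X bs" "A \<subseteq> set bs" by auto
  obtain cs where cs: "deduction RI X cs" "last cs = a"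
    using insert.prems by (auto simp: deducible_def)
  then have "a \<in> set cs" by (auto simp: deduction_iff)
  with bs cs have "deduction RI X (bs @ cs)" "insert a A \<subseteq> set (bs @ cs)"
    by (auto intro: deduction_append)
  then show ?case by blast
qed

text \<open>The step uses finitely many deducible premises. Their deductions are concatenated into
  one, and the conclusion is appended.\<close>

lemma deducible_infers:
  assumes "infers RI {x. deducible RI X x} a"
  shows "deducible RI X a"
proof -
  obtain A where A: "finite A" "A \<subseteq> {x. deducible RI X x}" "infers RI A a"
    using infers_finite[OF assms] .
  then obtain bs where bs: "bs = [] \<or> deduction RI X bs" "A \<subseteq> set bs"
    using finite_deducible_joint_deduction[of A RI X] by blast
  then have "deduction RI X (bs @ [a])"
    using infers_mono[OF A(3)] by (blast intro: deduction_snoc)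
  then show ?thesis by (force simp: deducible_def)
qed

lemma deducible_cut: "deducible RI {x. deducible RI X x} x \<Longrightarrow> deducible RI X x"
  by (drule deducible_closed[OF _ order_refl]) (simp_all add: deducible_infers)

lemma deducible_finite:
  assumes "deducible RI X x"
  obtains F where "F \<in> Fpow X" "deducible RI F x"
proof -
  obtain bs where bs: "deduction RI X bs" "last bs = x"
    using assms by (auto simp: deducible_def)
  \<comment> \<open>Only premises that occur as terms of \<open>bs\<close> are ever used, and there
    are finitely many terms.\<close>
  then have "deduction RI (X \<inter> set bs) bs"
    by (auto simp: deduction_iff)
  with bs have "deducible RI (X \<inter> set bs) x"
    by (auto simp: deducible_def)
  moreover have "X \<inter> set bs \<in> Fpow X"
    by (simp add: Fpow_def)
  ultimately show thesis using that by blast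
qed

section \<open>Generated operators and meets of consequence operators\<close>

lemma generates_finite_consequence_operator:
  assumes "generates RI C"
  shows "finite_consequence_operator C"
proof -
  have C: "C X = {x. deducible RI X x}" for X
    using assms by (simp add: generates_def)
  have ext: "X \<subseteq> C X" for X
    by (auto simp: C deducible_premise)
  have mono: "X \<subseteq> Y \<Longrightarrow> C X \<subseteq> C Y" for X Y
    by (auto simp: C intro: deducible_mono)
  have "C (C X) \<subseteq> C X" for X
    by (auto simp: C intro: deducible_cut)
  then have idem: "C X = C (C X)" for X
    using ext by blast
  have "C X = (\<Union>F \<in> Fpow X. C F)" for X
  proof
    show "C X \<subseteq> (\<Union>F \<in> Fpow X. C F)"
      by (auto simp: C elim: deducible_finite)
    show "(\<Union>F \<in> Fpow X. C F) \<subseteq> C X"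
      using mono by (auto simp: Fpow_def)
  qed
  with ext mono idem show ?thesis
    unfolding finite_consequence_operator_def general_consequence_operator_def by blast
qed

text \<open>Idempotence is the point with content: for each \<open>C\<close> in \<open>H\<close>,
  \<open>meet H\<close> lies below \<open>C\<close>, whence \<open>meet H (meet H X) \<subseteq> C
  (meet H X) \<subseteq> C (C X) = C X\<close>.\<close>

lemma general_consequence_operator_meet:
  assumes "\<forall>C \<in> H. general_consequence_operator C"
  shows "general_consequence_operator (meet H)"
proof -
  have ext: "X \<subseteq> meet H X" for X
    using assms by (auto simp: meet_def general_consequence_operator_def)
  have mono: "meet H X \<subseteq> meet H Y" if "X \<subseteq> Y" for X Y
    unfolding meet_def
  proof (rule INF_mono)
    fix C assume C: "C \<in> H"
    have "C X \<subseteq> C Y"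
      using assms that C by (simp add: general_consequence_operator_def)
    then show "\<exists>D \<in> H. D X \<subseteq> C Y" using C by (rule bexI)
  qed
  have "meet H (meet H X) \<subseteq> meet H X" for X
  proof -
    have "meet H (meet H X) \<subseteq> C X" if C: "C \<in> H" for C
    proof -
      have below: "meet H Y \<subseteq> C Y" for Y using C by (auto simp: meet_def)
      then have "C (meet H X) \<subseteq> C (C X)"
        using assms C by (simp add: general_consequence_operator_def)
      also have "C (C X) = C X"
        using assms C unfolding general_consequence_operator_def by metis
      finally show ?thesis using below by (rule order_trans[rotated])
    qed
    then show ?thesis unfolding meet_def[of H X] by (rule INF_greatest)
  qed
  with ext mono show ?thesis
    unfolding general_consequence_operator_def by blast
qed

section \<open>The rules \<open>R1 m\<close> and \<open>R3\<close>, and a countermodel\<close>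

lemma deducible_R1: "A \<in> axioms \<union> {J m} \<Longrightarrow> deducible {R1 m, R3} X A"
  by (rule deducible_infers, rule infers_axiom[of "R1 m"]) (use nary_R1 in \<open>auto simp: R1_def simp del: One_nat_def\<close>)

lemma infers_mp: "{A \<^bold>\<rightarrow> B, A} \<subseteq> Y \<Longrightarrow> infers {R1 m, R3} Y B"
  unfolding infers_def using nary_R3
  \<comment> \<open>Unfolding the numeral 3 into successors matches the arity in
    \<open>nary_R3\<close> with the length of the premise list plus one.\<close>
  by (intro disjI2 exI[of _ "[A \<^bold>\<rightarrow> B, A]"] exI[of _ R3]) (simp add: eval_nat_numeral R3_def)

lemma deducible_mp:
  "deducible {R1 m, R3} X (A \<^bold>\<rightarrow> B) \<Longrightarrow> deducible {R1 m, R3} X A \<Longrightarrow> deducible {R1 m, R3} X B"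
  by (rule deducible_infers, rule infers_mp[of A]) auto

text \<open>List lengths decide which rule was applied: \<open>R1 m\<close> holds only singletons
  and \<open>R3\<close> only triples.\<close>

lemma infers_R1_R3:
  assumes "infers {R1 m, R3} Y a"
  shows "a \<in> axioms \<union> {J m} \<or> (\<exists>A. A \<^bold>\<rightarrow> a \<in> Y \<and> A \<in> Y)"
  using assms unfolding infers_def by (auto simp: R1_def R3_def append_eq_Cons_conv)

text \<open>The guard \<open>A \<noteq> Var 0\<close> is the only departure from a classical
  valuation. It makes \<open>Neg (Var 0)\<close> false, so every implication from it is vacuously
  true, while \<open>J m\<close> holds because \<open>Var m\<close> is false.\<close>

primrec holds :: "nat \<Rightarrow> form \<Rightarrow> bool" where
  "holds m (Var i) \<longleftrightarrow> i \<noteq> 0 \<and> i \<noteq> m"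
| "holds m (Neg A) \<longleftrightarrow> A \<noteq> Var 0 \<and> \<not> holds m A"
| "holds m (A \<^bold>\<rightarrow> B) \<longleftrightarrow> (holds m A \<longrightarrow> holds m B)"

lemma Var_0_notin_L': "Var 0 \<notin> L'"
  by (auto simp: L'_def elim: language.cases)

text \<open>The first two schemes are valid whatever \<open>Neg\<close> means. In the third,
  \<open>X \<in> L'\<close> rules out \<open>X = Var 0\<close>, the one case where the guard could
  falsify it.\<close>

lemma holds_axioms: "A \<in> axioms \<Longrightarrow> holds m A"
  using Var_0_notin_L' by (auto simp: axioms_def)

lemma deducible_holds:
  assumes "deducible {R1 m, R3} F x" "\<forall>A \<in> F. holds m A"
  shows "holds m x"
proof -
  have "x \<in> Collect (holds m)"
  proof (rule deducible_closed[OF assms(1)])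
    show "F \<subseteq> Collect (holds m)" using assms(2) by blast
    fix a assume "infers {R1 m, R3} (Collect (holds m)) a"
    then show "a \<in> Collect (holds m)"
      using infers_R1_R3 holds_axioms by (fastforce simp: J_def)
  qed
  then show ?thesis by simp
qed

theorem mainTheorem4:
  fixes C' :: "nat \<Rightarrow> form set \<Rightarrow> form set"
  assumes "\<And>m. m \<ge> 1 \<Longrightarrow> generates {R1 m, R3} (C' m)"
  shows "(\<forall>m \<ge> 1. finite_consequence_operator (C' m)) \<and>
         general_consequence_operator (meet {C' m | m. m \<ge> 1}) \<and>
         \<not> finite_consequence_operator (meet {C' m | m. m \<ge> 1})"
proof (intro conjI)
  show fin: "\<forall>m \<ge> 1. finite_consequence_operator (C' m)"
    using assms generates_finite_consequence_operator by blast
  then show "general_consequence_operator (meet {C' m | m. m \<ge> 1})"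
    by (intro general_consequence_operator_meet) (auto simp: finite_consequence_operator_def)
  have C': "C' m X = {x. deducible {R1 m, R3} X x}" if "m \<ge> 1" for m X
    using assms[OF that] by (simp add: generates_def)
  define X where "X = (\<Union>m \<in> {1..}. {Var m, Neg (Var 0) \<^bold>\<rightarrow> Neg (Var m)})"
  have "Var 0 \<in> C' m X" if "m \<ge> 1" for m
  proof -
    have "Var m \<in> X" "Neg (Var 0) \<^bold>\<rightarrow> Neg (Var m) \<in> X"
      using that by (auto simp: X_def)
    moreover have "deducible {R1 m, R3} X (J m)"
      by (rule deducible_R1) simp
    ultimately have "deducible {R1 m, R3} X (Var 0)"
      unfolding J_def by (meson deducible_mp deducible_premise)
    then show ?thesis using C'[OF that] by simp
  qed
  then have in_meet: "Var 0 \<in> meet {C' m | m. m \<ge> 1} X"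
    by (auto simp: meet_def)
  have notin_meet: "Var 0 \<notin> meet {C' m | m. m \<ge> 1} F" if F: "F \<in> Fpow X" for F
  proof -
    \<comment> \<open>\<open>Var\<close> is injective, so the finite \<open>F\<close> contains
      finitely many variables; inserting 0 makes the fresh index satisfy
      \<open>m \<ge> 1\<close>.\<close>
    have "finite (insert 0 {i. Var i \<in> F})"
      using F finite_vimageI[of F Var] by (simp add: Fpow_def vimage_def inj_def)
    then obtain m where "m \<notin> insert 0 {i. Var i \<in> F}"
      using ex_new_if_finite infinite_UNIV_nat by blast
    then have m: "m \<ge> 1" "Var m \<notin> F" by auto
    \<comment> \<open>A variable in \<open>F\<close> has an index different from 0 and
      \<open>m\<close>; every other member of \<open>F\<close> is an implication from the false
      \<open>Neg (Var 0)\<close>.\<close>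
    have "\<forall>A \<in> F. holds m A"
      using F m by (auto simp: Fpow_def X_def)
    then have "\<not> deducible {R1 m, R3} F (Var 0)"
      using deducible_holds by fastforce
    then show ?thesis using m(1) C' by (auto simp: meet_def)
  qed
  show "\<not> finite_consequence_operator (meet {C' m | m. m \<ge> 1})"
    using in_meet notin_meet unfolding finite_consequence_operator_def by blast
qed

end
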